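(* Let $n\ge 2$ be an integer and $T\ge r>0$ real numbers. Let $L=\{\ell_1,\dots,\ell_n\}$ be a list of real numbers such that $\ell_1=T$, $\ell_i\ge \ell_{i+1}$ for $1\le i<n$, and $\ell_n=r$. Let $M'=\{T,b,\dots,b,r\}$ be the list of length $n$ in which $b$ appears $n-2$ times, where $b=T\alpha^{\alpha/(1+\alpha)}$ and $\alpha=\frac{r}{T}$. Then $E(L)\le E(M')$.
   Context: For a finite list $L=\{\ell_1,\dots,\ell_n\}$ (with repetitions allowed) of positive real numbers (the lengths of the bars of a persistence barcode), the persistent entropy is $E(L)=-\sum_{i=1}^n p_i\log(p_i)$, where $p_i=\ell_i/S_L$ and $S_L=\sum_{i=1}^n\ell_i$. *)

theory Defs
  imports Complex_Main
begin

text \<open>A barcode is represented by the list of the lengths of its bars; the order of the list is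
  irrelevant for the entropy. The logarithm is the natural one. The definition is meaningful for
  nonempty lists of positive reals.\<close>

definition total_length :: "real list \<Rightarrow> real" where
  "total_length L = (\<Sum>i<length L. L ! i)"

definition persistent_entropy :: "real list \<Rightarrow> real" where
  "persistent_entropy L =
     - (\<Sum>i<length L. (L ! i / total_length L) * ln (L ! i / total_length L))"

end

theory Submission
  imports Defs
begin

text \<open>Gibbs' inequality bounds $E(L)$ by the cross entropy of $L$ relative to $M'$. The value of
  $b$ is the one with $T \ln T + r \ln r = (T + r) \ln b$; it makes this cross entropy equal to
  $\ln S_{M'} - \ln b$ for every list $L$ with end points $T$ and $r$, in particular for $M'$
  itself.\<close>

text \<open>The estimate ln x \<le> x - 1 at x = \<open>q i / p i\<close>, multiplied by
  \<open>p i\<close>, bounds each difference of terms by \<open>q i - p i\<close>. These bounds sum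
  to zero because the total masses agree.\<close>

lemma gibbs_inequality:
  fixes p q :: "'a \<Rightarrow> real"
  assumes "\<And>i. i \<in> I \<Longrightarrow> p i > 0" and "\<And>i. i \<in> I \<Longrightarrow> q i > 0"
    and "sum p I = sum q I"
  shows "(\<Sum>i\<in>I. p i * ln (q i)) \<le> (\<Sum>i\<in>I. p i * ln (p i))"
proof -
  have "p i * ln (q i) - p i * ln (p i) \<le> q i - p i" if "i \<in> I" for i
  proof -
    have pos: "p i > 0" "q i > 0"
      using assms that by auto
    have "p i * ln (q i / p i) \<le> p i * (q i / p i - 1)"
      using pos by (intro mult_left_mono ln_le_minus_one) auto
    then show ?thesis
      using pos by (simp add: ln_div right_diff_distrib)
  qed
  then have "(\<Sum>i\<in>I. p i * ln (q i) - p i * ln (p i)) \<le> (\<Sum>i\<in>I. q i - p i)"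
    by (rule sum_mono)
  then show ?thesis
    using assms(3) by (simp add: sum_subtractf)
qed

lemma total_length_pos:
  assumes "L \<noteq> []" and "\<And>i. i < length L \<Longrightarrow> L ! i > 0"
  shows "total_length L > 0"
  unfolding total_length_def using assms by (intro sum_pos) auto

text \<open>Dividing each list by its total turns both into positive weights of sum 1, the setting
  of Gibbs' inequality.\<close>

lemma persistent_entropy_le_cross_entropy:
  assumes "length L = length M" and "L \<noteq> []"
    and "\<And>i. i < length L \<Longrightarrow> L ! i > 0" and "\<And>i. i < length M \<Longrightarrow> M ! i > 0"
  shows "persistent_entropy L \<le>
    - (\<Sum>i<length L. (L ! i / total_length L) * ln (M ! i / total_length M))"
proof -
  have pos: "total_length L > 0" "total_length M > 0"
    using assms by (auto intro!: total_length_pos)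
  have "(\<Sum>i<length L. L ! i / total_length L) = 1"
    "(\<Sum>i<length L. M ! i / total_length M) = 1"
    using pos assms(1) by (simp_all add: total_length_def flip: sum_divide_distrib)
  then show ?thesis
    unfolding persistent_entropy_def neg_le_iff_le
    using pos assms by (intro gibbs_inequality) auto
qed

text \<open>The right-hand side does not mention \<open>X\<close>: this is what lets two lists with
  the same ends be compared. The lemma serves twice, with \<open>X\<close> the given list and with
  \<open>X\<close> the list \<open>M\<close> itself, both times with \<open>N\<close> the total of
  \<open>M\<close>.\<close>

lemma cross_entropy_eq:
  assumes ends: "n \<ge> 2" "length X = n" "X ! 0 = T" "X ! (n - 1) = r"
    and pos: "total_length X > 0" "N > 0" "T > 0" "r > 0" "b > 0"
    and b: "T * ln T + r * ln r = (T + r) * ln b"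
    and M: "M = [T] @ replicate (n - 2) b @ [r]"
  shows "(\<Sum>i<n. (X ! i / total_length X) * ln (M ! i / N)) = ln b - ln N"
proof -
  have M0: "M ! 0 = T" and Mlast: "M ! (n - 1) = r"
    and Mmid: "\<And>i. 0 < i \<Longrightarrow> i < n - 1 \<Longrightarrow> M ! i = b"
    using ends(1) by (auto simp: M nth_append nth_Cons')
  have Mpos: "M ! i > 0" if "i < n" for i
    using that M0 Mlast Mmid[of i] pos by (cases "i = 0"; cases "i = n - 1") auto
  \<comment> \<open>Inner entries of \<open>M\<close> equal \<open>b\<close>, so their terms vanish.
    The two end terms, at distinct indices since n \<ge> 2, cancel by the choice of
    \<open>b\<close>.\<close>
  have "(\<Sum>i<n. X ! i * (ln (M ! i) - ln b)) = (\<Sum>i\<in>{0, n - 1}. X ! i * (ln (M ! i) - ln b))"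
    using ends(1) Mmid by (intro sum.mono_neutral_right) auto
  also have "\<dots> = 0"
    using ends b M0 Mlast by (simp add: algebra_simps)
  finally have zero: "(\<Sum>i<n. X ! i * (ln (M ! i) - ln b)) = 0" .
  \<comment> \<open>Insert \<open>ln b\<close>: the logarithm splits into
    \<open>ln (M ! i) - ln b\<close>, whose weighted sum is \<open>zero\<close>, and the constant
    \<open>ln b - ln N\<close>, whose weights sum to 1.\<close>
  have "(\<Sum>i<n. (X ! i / total_length X) * ln (M ! i / N)) =
      (\<Sum>i<n. X ! i * (ln (M ! i) - ln b) / total_length X + X ! i * ((ln b - ln N) / total_length X))"
  proof (intro sum.cong refl)
    fix i assume "i \<in> {..<n}"
    then have "ln (M ! i / N) = ln (M ! i) - ln N"
      using Mpos[of i] pos by (simp add: ln_div)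
    then show "(X ! i / total_length X) * ln (M ! i / N) =
        X ! i * (ln (M ! i) - ln b) / total_length X + X ! i * ((ln b - ln N) / total_length X)"
      by (simp add: right_diff_distrib diff_divide_distrib)
  qed
  also have "\<dots> = (\<Sum>i<n. X ! i) * ((ln b - ln N) / total_length X)"
    by (simp only: sum.distrib zero flip: sum_divide_distrib sum_distrib_right)
  also have "\<dots> = ln b - ln N"
    using pos(1) ends(2) by (simp add: total_length_def)
  finally show ?thesis .
qed

theorem proposition14:
  fixes n :: nat and T r \<alpha> b :: real and L :: "real list"
  assumes "n \<ge> 2"
    and "T \<ge> r" and "r > 0"
    and "length L = n"
    and "L ! 0 = T"
    and "\<And>i. i + 1 < n \<Longrightarrow> L ! i \<ge> L ! (i + 1)"
    and "L ! (n - 1) = r"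
    and "\<alpha> = r / T"
    and "b = T * \<alpha> powr (\<alpha> / (1 + \<alpha>))"
  shows "persistent_entropy L \<le> persistent_entropy ([T] @ replicate (n - 2) b @ [r])"
proof -
  define M where "M = [T] @ replicate (n - 2) b @ [r]"
  have T: "T > 0" and \<alpha>: "\<alpha> > 0"
    using assms(2,3,8) by auto
  have b: "b > 0"
    using T \<alpha> assms(9) by simp
  \<comment> \<open>Since the exponent is r / (T + r), \<open>b\<close> is the geometric mean of
    \<open>T\<close> and \<open>r\<close> with weights proportional to \<open>T\<close> and
    \<open>r\<close> themselves.\<close>
  have "ln b = ln T + \<alpha> / (1 + \<alpha>) * ln \<alpha>"
    using T \<alpha> by (simp add: assms(9) ln_mult ln_powr)
  also have "\<alpha> / (1 + \<alpha>) = r / (T + r)"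
  proof -
    have "1 + \<alpha> = (T + r) / T"
      using T assms(8) by (simp add: add_divide_distrib)
    then show ?thesis
      using T assms(8) by simp
  qed
  finally have "(T + r) * ln b = (T + r) * ln T + r * (ln r - ln T)"
    using T assms(3,8) by (simp add: ln_div distrib_left)
  then have b_eq: "T * ln T + r * ln r = (T + r) * ln b"
    by (simp add: algebra_simps)
  \<comment> \<open>Downward induction from the last index; the ordering of \<open>L\<close> thus
    yields the positivity that Gibbs' inequality asks for.\<close>
  have "L ! i \<ge> r" if "i \<le> n - 1" for i
    using that
  proof (induction rule: inc_induct)
    case base
    then show ?case using assms(7) by simp
  next
    case (step k)
    then show ?case using assms(6)[of k] by (simp add: less_diff_conv)
  qed
  then have L_pos: "L ! i > 0" if "i < length L" for i
    using that assms(3,4) less_le_trans[of 0 r "L ! i"] by simp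
  have M_len: "length M = n"
    using assms(1) by (simp add: M_def)
  have M_ends: "M ! 0 = T" "M ! (n - 1) = r"
    using assms(1) by (auto simp: M_def nth_append nth_Cons')
  have M_pos: "M ! i > 0" if "i < length M" for i
  proof -
    have "M ! i \<in> set M"
      using that by (rule nth_mem)
    then show ?thesis
      using T b assms(3) by (auto simp: M_def)
  qed
  have ne: "L \<noteq> []" "M \<noteq> []"
    using assms(1,4) by (auto simp: M_def)
  have tot: "total_length L > 0" "total_length M > 0"
    using ne L_pos M_pos by (auto intro: total_length_pos)
  have "persistent_entropy L \<le>
      - (\<Sum>i<n. (L ! i / total_length L) * ln (M ! i / total_length M))"
    using persistent_entropy_le_cross_entropy[of L M] L_pos M_pos ne assms(4) M_len by simp
  also have "\<dots> = - (ln b - ln (total_length M))"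
    by (simp only: cross_entropy_eq[OF assms(1,4,5,7) tot T assms(3) b b_eq M_def])
  \<comment> \<open>The same formula read backwards with \<open>X\<close> = \<open>M\<close>: the
    cross entropy of \<open>M\<close> relative to itself is its entropy.\<close>
  also have "\<dots> = - (\<Sum>i<n. (M ! i / total_length M) * ln (M ! i / total_length M))"
    by (simp only: cross_entropy_eq[OF assms(1) M_len M_ends tot(2,2) T assms(3) b b_eq M_def])
  also have "\<dots> = persistent_entropy M"
    by (simp add: persistent_entropy_def M_len)
  finally show ?thesis
    by (simp add: M_def)
qed

end
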